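(* Let $f(z)=zh(z)\overline{g(z)}$, with $h,g$ analytic in $U=\{z\in\mathbb{C}:|z|<1\}$, be a univalent sense-preserving logharmonic mapping in $U$ normalized by $h(0)=1=g(0)$, whose second dilatation function $a$ has real coefficients. Suppose further that $\Omega=f(U)$ is a strictly starlike Jordan domain, that is, each radial ray from $0$ intersects the boundary $\partial\Omega$ of $\Omega$ in exactly one point of $\mathbb{C}$. If $f(U)$ is a symmetric domain with respect to the real axis, then $\varphi(z)=zh(z)g(z)$ is typically real in the disk $|z|<\sqrt{2}-1$.
   Context: A function $f$ on $U$ is a logharmonic mapping if $\overline{\left(f_{\overline z}/f\right)}=a\,f_z/f$ in $U$ (where $f\neq 0$) for some analytic $a:U\to\mathbb{C}$ with $|a|<1$; $a$ is called the second dilatation function of $f$. That $a$ has real coefficients means $a(\overline z)=\overline{a(z)}$ for $z\in U$. Univalent means injective. An analytic function $\varphi$ is typically real in a disk $D$ centered at $0$ if $\varphi(z)$ is real whenever $z\in D$ is real and $\varphi(z)$ is nonreal for all other $z\in D$. *)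

theory Defs
  imports "HOL-Complex_Analysis.Complex_Analysis"
begin

text \<open>Wirtinger derivatives \<open>f\<^sub>z = (f\<^sub>x - i f\<^sub>y)/2\<close> and \<open>f\<^bsub>cnj z\<^esub> = (f\<^sub>x + i f\<^sub>y)/2\<close>; the real partial
  derivatives are the values of the (real) Frechet derivative at \<open>1\<close> and \<open>\<i>\<close>.\<close>

definition wirtinger_z :: "(complex \<Rightarrow> complex) \<Rightarrow> complex \<Rightarrow> complex" where
  "wirtinger_z f z =
     (frechet_derivative f (at z) 1 - \<i> * frechet_derivative f (at z) \<i>) / 2"

definition wirtinger_zbar :: "(complex \<Rightarrow> complex) \<Rightarrow> complex \<Rightarrow> complex" where
  "wirtinger_zbar f z =
     (frechet_derivative f (at z) 1 + \<i> * frechet_derivative f (at z) \<i>) / 2"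

text \<open>The requirement \<open>f differentiable (at z)\<close> is real differentiability, without which the Wirtinger
  derivatives would carry no meaning.\<close>

definition second_dilatation ::
    "(complex \<Rightarrow> complex) \<Rightarrow> (complex \<Rightarrow> complex) \<Rightarrow> complex set \<Rightarrow> bool" where
  "second_dilatation f a U \<longleftrightarrow>
     a holomorphic_on U \<and> (\<forall>z\<in>U. cmod (a z) < 1) \<and>
     (\<forall>z\<in>U. f z \<noteq> 0 \<longrightarrow>
        cnj (wirtinger_zbar f z / f z) = a z * (wirtinger_z f z / f z))"

definition logharmonic_on :: "(complex \<Rightarrow> complex) \<Rightarrow> complex set \<Rightarrow> bool" where
  "logharmonic_on f U \<longleftrightarrow>
     (\<forall>z\<in>U. f differentiable (at z)) \<and> (\<exists>a. second_dilatation f a U)"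

text \<open>\<open>|f\<^sub>z|\<^sup>2 - |f\<^bsub>cnj z\<^esub>|\<^sup>2\<close> is the Jacobian determinant of \<open>f\<close> as a map of the real plane.\<close>

definition sense_preserving_on :: "(complex \<Rightarrow> complex) \<Rightarrow> complex set \<Rightarrow> bool" where
  "sense_preserving_on f U \<longleftrightarrow>
     (\<forall>z\<in>U. (cmod (wirtinger_z f z))\<^sup>2 - (cmod (wirtinger_zbar f z))\<^sup>2 > 0)"

definition jordan_domain :: "complex set \<Rightarrow> bool" where
  "jordan_domain \<Omega> \<longleftrightarrow>
     (\<exists>c. simple_path c \<and> pathfinish c = pathstart c \<and> \<Omega> = inside (path_image c))"

definition radial_ray :: "complex \<Rightarrow> complex set" where
  "radial_ray u = {of_real t * u |t::real. t \<ge> 0}"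

text \<open>The ray condition alone does not force a simply connected domain to be starlike (delete from
  the plane two suitable spiral slits running to infinity); for Jordan domains containing \<open>0\<close> it does.\<close>

definition strictly_starlike_jordan_domain :: "complex set \<Rightarrow> bool" where
  "strictly_starlike_jordan_domain \<Omega> \<longleftrightarrow>
     jordan_domain \<Omega> \<and> (\<forall>u. cmod u = 1 \<longrightarrow> (\<exists>!w. w \<in> radial_ray u \<inter> frontier \<Omega>))"

definition typically_real_on :: "(complex \<Rightarrow> complex) \<Rightarrow> complex set \<Rightarrow> bool" where
  "typically_real_on \<phi> D \<longleftrightarrow>
     \<phi> holomorphic_on D \<and>
     (\<forall>z\<in>D. z \<in> \<real> \<longrightarrow> \<phi> z \<in> \<real>) \<and> (\<forall>z\<in>D. z \<notin> \<real> \<longrightarrow> \<phi> z \<notin> \<real>)"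

end

theory Submission imports Defs
begin

text \<open>Since \<open>f\<close> is injective with \<open>f 0 = 0\<close>, the functions \<open>h\<close> and \<open>g\<close> have no zeros, so \<open>h = exp H\<close> and
\<open>g = exp G\<close> with \<open>H 0 = G 0 = 0\<close>. Next to \<open>f = z exp (H + cnj G)\<close> stand the analytic functions
\<open>\<psi> = z exp (H - G)\<close> and \<open>\<phi> = z exp (H + G)\<close>. They split \<open>f\<close> into its polar parts:
\<open>arg f = arg \<psi>\<close> and \<open>\<bar>f\<bar> = \<bar>\<phi>\<bar>\<close>. The dilatation equation becomes \<open>z G' = a (1 + z H')\<close>, hence
\<open>z\<psi>'/\<psi> = (1 - a)(1 + z H')\<close> and \<open>z\<phi>'/\<phi> = (1 + a)(1 + z H')\<close>; the two differ by the factor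
\<open>(1 + a)/(1 - a)\<close>, whose real part is positive. So where \<open>arg f\<close> stays constant, \<open>\<bar>\<psi>\<bar>\<close> and \<open>\<bar>f\<bar>\<close>
grow together. This principle is \<open>increments_have_same_sign_on_level_line\<close>; it is used twice.

First, it gives the uniqueness argument that makes \<open>H\<close> and \<open>G\<close> real on the real axis
(\<open>real_on_real_axis\<close>). The map \<open>f\<^sub>c(z) = cnj (f (cnj z))\<close> has the same dilatation and the same image
as \<open>f\<close>. The logarithm of \<open>f/f\<^sub>c\<close> has the form \<open>K + cnj L\<close> with \<open>L' = a K'\<close>. Consider the
points where it is real and at least some \<open>e > 0\<close>. They cannot accumulate at the unit circle, because
two points of the frontier of the image on the same ray agree; so these points form a compact set, and
there is a largest such value. But if \<open>K\<close> is not constant, such values exist for some \<open>e\<close>, and from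
every point where the logarithm is real one can move to a larger real value.

Secondly, pull the radial segments of the starlike image back by \<open>f\<close>. Along the resulting curves
\<open>\<bar>\<psi>\<bar>\<close> increases strictly while \<open>arg \<psi>\<close> is fixed, so \<open>\<psi>\<close> is univalent with starlike image. By the
Schwarz lemma \<open>Re (z\<psi>'/\<psi>) \<ge> 0\<close> (\<open>Re_starlike_nonneg\<close>). Thus \<open>z\<psi>'/\<psi> = (1 + \<omega>)/(1 - \<omega>)\<close> with
\<open>\<bar>\<omega>(z)\<bar> \<le> \<bar>z\<bar>\<close>, and also \<open>\<bar>a(z)\<bar> \<le> \<bar>z\<bar>\<close>. Each of the two factors of
\<open>z\<phi>'/\<phi> = (1 + a)/(1 - a) \<cdot> (1 + \<omega>)/(1 - \<omega>)\<close> therefore has argument at most \<open>2 arctan \<bar>z\<bar>\<close>, and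
\<open>4 arctan \<bar>z\<bar> < \<pi>/2\<close> holds precisely for \<open>\<bar>z\<bar> < tan (\<pi>/8) = sqrt 2 - 1\<close>. On such circles \<open>arg \<phi>\<close> is
strictly increasing; as \<open>\<phi>\<close> is real on the real axis, \<open>arg \<phi>\<close> runs from \<open>0\<close> to \<open>\<pi>\<close> over the upper half
of the circle, so \<open>\<phi>\<close> is not real there. Reflection settles the lower half.\<close>

section \<open>Growth along level lines\<close>

lemma Re_Cayley_pos:
  assumes "cmod w < 1"
  shows "Re ((1 + w) / (1 - w)) > 0"
proof -
  have w1: "w \<noteq> 1" using assms by auto
  have "(1 + w) / (1 - w) = (1 + w) * cnj (1 - w) / of_real ((cmod (1 - w))\<^sup>2)"
    using complex_div_cnj[of "1 + w" "1 - w"] by simp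
  then have "Re ((1 + w) / (1 - w)) = Re ((1 + w) * cnj (1 - w)) / (cmod (1 - w))\<^sup>2"
    by (simp only: Re_divide_of_real)
  also have "Re ((1 + w) * cnj (1 - w)) = 1 - (cmod w)\<^sup>2"
    unfolding cmod_power2 by (simp add: algebra_simps power2_eq_square)
  finally show ?thesis using assms w1 by (simp add: power_less_one_iff abs_square_less_1)
qed

text \<open>By de l'Hospital's rule \<open>(M z - M z0) / (q z - q z0)\<close> tends to \<open>P z0\<close> for \<open>z \<rightarrow> z0\<close>. So for \<open>z\<close> near \<open>z0\<close>
a real increment of \<open>q\<close> forces an increment of \<open>M\<close> whose real part has the same sign. The point \<open>z0\<close>
may be a critical point of \<open>q\<close>; therefore the error term \<open>R = M - P z0 * q\<close> is compared with
\<open>\<bar>z - z0\<bar>\<^sup>n\<close>, where \<open>n\<close> is the order of \<open>q - q z0\<close> at \<open>z0\<close>.\<close>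

lemma increments_have_same_sign_on_level_line:
  fixes q M P :: "complex \<Rightarrow> complex"
  assumes S: "open S" "connected S" "z0 \<in> S"
    and q: "q holomorphic_on S" "\<not> q constant_on S"
    and M: "M holomorphic_on S" "\<And>z. z \<in> S \<Longrightarrow> deriv M z = P z * deriv q z"
    and P: "isCont P z0" "Re (P z0) > 0"
  obtains \<delta> where "\<delta> > 0" "ball z0 \<delta> \<subseteq> S"
    "\<And>z. \<lbrakk>z \<in> ball z0 \<delta>; z \<noteq> z0; Im (q z) = Im (q z0)\<rbrakk>
       \<Longrightarrow> (Re (q z) - Re (q z0)) * (Re (M z) - Re (M z0)) > 0"
proof -
  have nc: "\<not> (\<lambda>z. q z - q z0) constant_on S"
    using q(2) unfolding constant_on_def by (metis diff_add_cancel)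
  have hol: "(\<lambda>z. q z - q z0) holomorphic_on S"
    by (intro holomorphic_intros q)
  have zero: "q z0 - q z0 = 0" by simp
  obtain g r n where n: "0 < n" and r: "0 < r" "ball z0 r \<subseteq> S"
    and g: "g holomorphic_on ball z0 r"
    and qg: "\<And>w. w \<in> ball z0 r \<Longrightarrow> q w - q z0 = (w - z0)^n * g w"
    and gnz: "\<And>w. w \<in> ball z0 r \<Longrightarrow> g w \<noteq> 0"
    by (rule holomorphic_factor_zero_nonconstant[OF hol S zero nc]) blast
  define B where "B = cball z0 (r/2)"
  have B: "B \<subseteq> ball z0 r" "compact B" "B \<noteq> {}" using r by (auto simp: B_def)
  have gc: "continuous_on B g" and g'c: "continuous_on B (deriv g)"
    using holomorphic_on_subset[OF g B(1)] holomorphic_on_subset[OF holomorphic_deriv[OF g open_ball] B(1)]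
    by (auto intro: holomorphic_on_imp_continuous_on)
  obtain c where c: "c > 0" "\<And>z. z \<in> B \<Longrightarrow> c \<le> cmod (g z)"
  proof -
    have "\<exists>x\<in>B. \<forall>y\<in>B. cmod (g x) \<le> cmod (g y)"
      using B by (intro continuous_attains_inf) (auto intro!: continuous_intros gc)
    then show ?thesis using that gnz B(1) by (metis subsetD zero_less_norm_iff)
  qed
  define D where "D z = of_nat n * g z + (z - z0) * deriv g z" for z
  have "continuous_on B D" unfolding D_def by (intro continuous_intros gc g'c)
  then have "bounded (D ` B)" using B(2) compact_continuous_image compact_imp_bounded by blast
  then obtain C where C: "C > 0" "\<And>z. z \<in> B \<Longrightarrow> cmod (D z) \<le> C"
    by (auto simp: bounded_pos)
  have dq: "deriv q z = (z - z0)^(n-1) * D z" if "z \<in> ball z0 r" for z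
  proof -
    have "(g has_field_derivative deriv g z) (at z)"
      using g that by (meson holomorphic_derivI open_ball)
    then have "((\<lambda>z. (z - z0)^n * g z + q z0) has_field_derivative
        of_nat n * (z - z0)^(n-1) * g z + (z - z0)^n * deriv g z) (at z)"
      by (auto intro!: derivative_eq_intros)
    moreover have "(z - z0)^n = (z - z0)^(n-1) * (z - z0)"
      using n by (metis mult.commute power_minus_mult)
    ultimately have "((\<lambda>z. (z - z0)^n * g z + q z0) has_field_derivative (z - z0)^(n-1) * D z) (at z)"
      by (simp add: D_def algebra_simps)
    moreover have "(w - z0)^n * g w + q z0 = q w" if "w \<in> ball z0 r" for w
      using qg[OF that] by (metis diff_add_cancel)
    ultimately have "(q has_field_derivative (z - z0)^(n-1) * D z) (at z)"
      using has_field_derivative_transform_within_open[OF _ open_ball that] by blast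
    then show ?thesis by (rule DERIV_imp_deriv)
  qed
  (* With this e the error R z - R z0 is at most half of Re (P z0) * |q z - q z0|. *)
  define e where "e = Re (P z0) * c / (2 * C)"
  have e: "e > 0" using P c C by (simp add: e_def)
  obtain d where d: "d > 0" "\<And>z. dist z z0 < d \<Longrightarrow> dist (P z) (P z0) < e"
    using P(1) e unfolding continuous_at_eps_delta by (metis dist_commute)
  define \<delta> where "\<delta> = min d (r/2)"
  define R where "R z = M z - P z0 * q z" for z
  have R_bound: "cmod (R z - R z0) \<le> e * C * cmod (z - z0) ^ n" if z: "z \<in> ball z0 \<delta>" for z
  proof -
    define A where "A = cball z0 (cmod (z - z0))"
    have AB: "A \<subseteq> B" "A \<subseteq> ball z0 d" using z by (auto simp: A_def B_def \<delta>_def dist_norm norm_minus_commute)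
    have "cmod (R z - R z0) \<le> (e * (cmod (z - z0)^(n-1) * C)) * cmod (z - z0)"
    proof (rule field_differentiable_bound[of A R "\<lambda>w. (P w - P z0) * deriv q w"])
      fix w assume w: "w \<in> A"
      then have wS: "w \<in> S" "w \<in> ball z0 r" "w \<in> B" using AB B r by auto
      have "(R has_field_derivative deriv M w - P z0 * deriv q w) (at w)"
        unfolding R_def using wS S q M
        by (auto intro!: derivative_eq_intros holomorphic_derivI)
      then show "(R has_field_derivative (P w - P z0) * deriv q w) (at w within A)"
        using M(2) wS by (auto simp: algebra_simps intro: has_field_derivative_at_within)
      have "cmod (P w - P z0) \<le> e" using d(2)[of w] w AB by (auto simp: dist_norm norm_minus_commute)
      moreover have "cmod (deriv q w) \<le> cmod (z - z0)^(n-1) * C"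
        using dq[OF wS(2)] C(2)[OF wS(3)] w
        by (auto simp: norm_mult norm_power A_def dist_norm norm_minus_commute intro!: mult_mono power_mono)
      ultimately show "cmod ((P w - P z0) * deriv q w) \<le> e * (cmod (z - z0)^(n-1) * C)"
        using e by (auto simp: norm_mult intro!: mult_mono)
    qed (auto simp: A_def dist_norm norm_minus_commute)
    also have "\<dots> = e * C * cmod (z - z0) ^ n" using n by (simp add: power_eq_if)
    finally show ?thesis .
  qed
  show ?thesis
  proof
    show "\<delta> > 0" using d r by (simp add: \<delta>_def)
    have "ball z0 \<delta> \<subseteq> B" using d r by (auto simp: \<delta>_def B_def)
    then show "ball z0 \<delta> \<subseteq> S" using B r by blast
    fix z assume z: "z \<in> ball z0 \<delta>" "z \<noteq> z0" "Im (q z) = Im (q z0)"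
    have zB: "z \<in> B" using z(1) \<open>ball z0 \<delta> \<subseteq> B\<close> by blast
    define s where "s = Re (q z) - Re (q z0)"
    have qs: "q z - q z0 = of_real s" using z(3) by (simp add: complex_eq_iff s_def)
    have "cmod (q z - q z0) = cmod (z - z0)^n * cmod (g z)"
      using qg zB B(1) by (metis norm_mult norm_power subsetD)
    then have low: "c * cmod (z - z0)^n \<le> \<bar>s\<bar>"
      using c(2)[OF zB] by (simp add: qs mult.commute[of _ "cmod (g z)"] mult_right_mono)
    moreover have pos: "c * cmod (z - z0)^n > 0" using c z by simp
    ultimately have s: "\<bar>s\<bar> > 0" by linarith
    have "cmod (R z - R z0) \<le> Re (P z0) / 2 * (c * cmod (z - z0) ^ n)"
      using R_bound[OF z(1)] C by (simp add: e_def field_simps)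
    also have "\<dots> \<le> Re (P z0) / 2 * \<bar>s\<bar>" using low P(2) by (intro mult_left_mono) auto
    finally have *: "\<bar>Re (R z) - Re (R z0)\<bar> \<le> Re (P z0) / 2 * \<bar>s\<bar>"
      by (metis abs_Re_le_cmod minus_complex.sel(1) order_trans)
    have "M z - M z0 = P z0 * of_real s + (R z - R z0)" 
      unfolding R_def qs[symmetric] by (simp add: algebra_simps)
    then have "Re (M z - M z0) = Re (P z0 * of_real s + (R z - R z0))" by simp
    then have "Re (M z) - Re (M z0) = Re (P z0) * s + (Re (R z) - Re (R z0))" by simp
    then have "s * (Re (M z) - Re (M z0)) = s * (Re (P z0) * s + (Re (R z) - Re (R z0)))" by simp
    also have "\<dots> = Re (P z0) * \<bar>s\<bar>^2 + s * (Re (R z) - Re (R z0))"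
      by (simp add: distrib_left power2_eq_square mult_ac)
    finally have "s * (Re (M z) - Re (M z0)) = Re (P z0) * \<bar>s\<bar>^2 + s * (Re (R z) - Re (R z0))" .
    moreover have "\<bar>s * (Re (R z) - Re (R z0))\<bar> \<le> Re (P z0) / 2 * \<bar>s\<bar>^2"
      using mult_left_mono[OF * abs_ge_zero[of s]] unfolding abs_mult[symmetric]
      by (simp only: power2_eq_square mult_ac)
    moreover have "Re (P z0) / 2 * \<bar>s\<bar>^2 > 0" using s P by simp
    ultimately have "s * (Re (M z) - Re (M z0)) > 0" by (simp add: abs_le_iff)
    then show "(Re (q z) - Re (q z0)) * (Re (M z) - Re (M z0)) > 0" by (simp add: s_def)
  qed
qed

text \<open>The open mapping theorem supplies points near \<open>z0\<close> at which \<open>q\<close> has a positive real increment, even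
when \<open>z0\<close> is a critical point of \<open>q\<close>.\<close>

lemma increase_on_level_line:
  fixes q M P :: "complex \<Rightarrow> complex"
  assumes S: "open S" "connected S" "z0 \<in> S"
    and q: "q holomorphic_on S" "\<not> q constant_on S"
    and M: "M holomorphic_on S" "\<And>z. z \<in> S \<Longrightarrow> deriv M z = P z * deriv q z"
    and P: "isCont P z0" "Re (P z0) > 0"
  obtains z where "z \<in> S" "Im (q z) = Im (q z0)" "Re (M z) > Re (M z0)"
proof -
  obtain \<delta> where \<delta>: "\<delta> > 0" "ball z0 \<delta> \<subseteq> S"
    and sgn: "\<And>z. \<lbrakk>z \<in> ball z0 \<delta>; z \<noteq> z0; Im (q z) = Im (q z0)\<rbrakk>
       \<Longrightarrow> (Re (q z) - Re (q z0)) * (Re (M z) - Re (M z0)) > 0"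
    using increments_have_same_sign_on_level_line[OF assms] by metis
  have "open (q ` ball z0 \<delta>)"
    using open_mapping_thm[OF q(1) S(1,2) open_ball \<delta>(2) q(2)] .
  moreover have "q z0 \<in> q ` ball z0 \<delta>" using \<delta> by simp
  ultimately obtain s where s: "s > 0" "cball (q z0) s \<subseteq> q ` ball z0 \<delta>"
    by (auto simp: open_contains_cball)
  have "q z0 + of_real s \<in> cball (q z0) s" using s by (simp add: dist_norm)
  then obtain z where z: "z \<in> ball z0 \<delta>" "q z = q z0 + of_real s" using s by (metis subsetD imageE)
  then have "z \<noteq> z0" using s by auto
  then have "Re (M z) > Re (M z0)"
    using sgn[of z] z s by (simp add: zero_less_mult_iff)
  then show ?thesis using that z \<delta> by (metis Im_complex_of_real add.right_neutral plus_complex.sel(2) subsetD)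
qed

text \<open>The maximum over \<open>{a..b}\<close> can only sit at \<open>b\<close>. This turns local growth to the right into global
growth without differentiating \<open>s\<close>.\<close>

lemma less_endpoint_if_always_improvable:
  fixes s :: "real \<Rightarrow> real"
  assumes "a < b" "continuous_on {a..b} s"
    and step: "\<And>t. \<lbrakk>a \<le> t; t < b\<rbrakk> \<Longrightarrow> \<exists>t'. t < t' \<and> t' \<le> b \<and> s t < s t'"
  shows "s a < s b"
proof -
  obtain m where m: "m \<in> {a..b}" "\<And>t. t \<in> {a..b} \<Longrightarrow> s t \<le> s m"
    using continuous_attains_sup[of "{a..b}" s] assms(1,2) by auto
  have "m = b"
  proof (rule ccontr)
    assume "m \<noteq> b"
    then obtain t' where "m < t'" "t' \<le> b" "s m < s t'" using step[of m] m(1) by auto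
    then show False using m(2)[of t'] m(1) by auto
  qed
  moreover obtain t' where "a < t'" "t' \<le> b" "s a < s t'" using step[of a] assms(1) by auto
  ultimately show ?thesis using m(2)[of t'] by auto
qed

section \<open>Injective maps of the disc and starlike images\<close>

text \<open>The inverse of \<open>f\<close> is continuous on the open image by invariance of domain, so a limit inside the
image would pull back to a limit of \<open>z\<close> inside the disc.\<close>

lemma frontier_limit_of_escaping_sequence:
  fixes f :: "complex \<Rightarrow> complex"
  assumes f: "continuous_on (ball 0 1) f" "inj_on f (ball 0 1)"
    and z: "\<And>n::nat. z n \<in> ball 0 1" "(\<lambda>n. cmod (z n)) \<longlonglongrightarrow> 1"
    and w: "(\<lambda>n. f (z n)) \<longlonglongrightarrow> w"
  shows "w \<in> frontier (f ` ball 0 1)"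
proof -
  have op: "open (f ` ball 0 1)" using invariance_of_domain f by blast
  have "w \<in> closure (f ` ball 0 1)"
    unfolding closure_sequential using z w by (intro exI[of _ "\<lambda>n. f (z n)"]) auto
  moreover have "w \<notin> f ` ball 0 1"
  proof
    assume wf: "w \<in> f ` ball 0 1"
    obtain g where g: "homeomorphism (ball 0 1) (f ` ball 0 1) f g"
      using invariance_of_domain_homeomorphism[of "ball 0 1" f] f by auto
    then have "isCont g w" using op wf
      using continuous_on_eq_continuous_at[OF op] homeomorphism_cont2[OF g] by blast
    then have "(\<lambda>n. g (f (z n))) \<longlonglongrightarrow> g w" using w isCont_tendsto_compose by blast
    then have "z \<longlonglongrightarrow> g w" using g z by (simp add: homeomorphism_apply1)
    then have "(\<lambda>n. cmod (z n)) \<longlonglongrightarrow> cmod (g w)" by (rule tendsto_norm)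
    then have "cmod (g w) = 1" using z LIMSEQ_unique by blast
    moreover have "g w \<in> ball 0 1" using g wf by (auto simp: homeomorphism_def)
    ultimately show False by simp
  qed
  ultimately show ?thesis using op by (simp add: frontier_def interior_open)
qed

text \<open>If a segment from \<open>0\<close> to \<open>w \<in> \<Omega>\<close> left \<open>\<Omega>\<close>, the ray through \<open>w\<close> would meet the frontier once
before \<open>w\<close> and, \<open>\<Omega>\<close> being bounded, once more beyond \<open>w\<close>.\<close>

lemma starlike_of_unique_ray_crossing:
  assumes Om: "open \<Omega>" "bounded \<Omega>" "0 \<in> \<Omega>"
    and ray: "\<forall>u. cmod u = 1 \<longrightarrow> (\<exists>!w. w \<in> radial_ray u \<inter> frontier \<Omega>)"
  shows "\<lbrakk>w \<in> frontier \<Omega>; of_real t * w \<in> frontier \<Omega>; t > 0\<rbrakk> \<Longrightarrow> t = 1"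
    and "\<lbrakk>w \<in> \<Omega>; 0 \<le> t; t \<le> 1\<rbrakk> \<Longrightarrow> of_real t * w \<in> \<Omega>"
proof -
  have fr: "x \<notin> \<Omega>" if "x \<in> frontier \<Omega>" for x using that Om by (simp add: frontier_def interior_open)
  have uniq: "s = t" if "s > 0" "t > 0" "of_real s * w \<in> frontier \<Omega>" "of_real t * w \<in> frontier \<Omega>"
    for s t w
  proof -
    have w0: "w \<noteq> 0" using that(3) fr Om by auto
    define u where "u = w / of_real (cmod w)"
    have u: "cmod u = 1" and wu: "w = of_real (cmod w) * u" using w0 by (auto simp: u_def norm_divide)
    have "of_real k * w \<in> radial_ray u" if "k > 0" for k
      unfolding radial_ray_def using that
      by (intro CollectI exI[of _ "k * cmod w"]) (subst wu, simp)
    then have "of_real s * w = (of_real t :: complex) * w" using ray u that by blast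
    then show ?thesis using w0 by simp
  qed
  show "t = 1" if "w \<in> frontier \<Omega>" "of_real t * w \<in> frontier \<Omega>" "t > 0" for w t
    using uniq[of t 1 w] that by simp
  show "of_real t * w \<in> \<Omega>" if w: "w \<in> \<Omega>" "0 \<le> t" "t \<le> 1"
  proof (rule ccontr)
    assume out: "of_real t * w \<notin> \<Omega>"
    have crossing: "\<exists>s\<in>{a..b}. of_real s * w \<in> frontier \<Omega>"
      if "a \<le> b" "(of_real a * w \<in> \<Omega>) \<noteq> (of_real b * w \<in> \<Omega>)" for a b
    proof -
      let ?I = "(\<lambda>s::real. of_real s * w) ` {a..b}"
      have "connected ?I" by (intro connected_continuous_image continuous_intros) auto
      moreover have "?I \<inter> \<Omega> \<noteq> {}" "?I - \<Omega> \<noteq> {}"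
        using that atLeastAtMost_iff[of a a b] atLeastAtMost_iff[of b a b] by blast+
      ultimately show ?thesis using connected_Int_frontier by blast
    qed
    have w0: "w \<noteq> 0" using out Om by auto
    obtain B where B: "\<And>x. x \<in> \<Omega> \<Longrightarrow> cmod x \<le> B" using Om(2) by (auto simp: bounded_iff)
    define b where "b = 1 + \<bar>B\<bar> / cmod w"
    have "cmod (of_real b * w) = \<bar>b\<bar> * cmod w" by (simp only: norm_mult norm_of_real)
    also have "\<dots> = cmod w + \<bar>B\<bar>" using w0 by (simp add: b_def field_simps)
    finally have "cmod (of_real b * w) = cmod w + \<bar>B\<bar>" .
    then have "of_real b * w \<notin> \<Omega>" using B[of "of_real b * w"] w0
      by (smt (verit) zero_less_norm_iff)
    moreover have b1: "1 \<le> b" by (simp add: b_def)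
    ultimately obtain s2 where s2: "1 \<le> s2" "of_real s2 * w \<in> frontier \<Omega>"
      using crossing[of 1 b] w by auto
    obtain s1 where s1: "0 \<le> s1" "s1 \<le> t" "of_real s1 * w \<in> frontier \<Omega>"
      using crossing[of 0 t] w Om out by auto
    have "s1 \<noteq> 0" using s1(3) fr Om by auto
    then have "s1 = s2" using uniq s1 s2 by force
    then have "s1 = 1" using s1 s2 w by linarith
    then show False using s1(3) fr w by auto
  qed
qed

section \<open>The analytic functions attached to a logharmonic map\<close>

text \<open>The situation after passing to logarithms: \<open>H\<close> and \<open>G\<close> are the logarithms of the two factors of
\<open>f\<close>. The assumption \<open>nz\<close> says that \<open>f\<^sub>z\<close> has no zero, and \<open>ray\<close>, \<open>bnd\<close> and \<open>star\<close> are the forms in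
which the geometry of the image enters.\<close>

locale starlike_logharmonic =
  fixes H G a f :: "complex \<Rightarrow> complex"
  assumes holH: "H holomorphic_on ball 0 1" and holG: "G holomorphic_on ball 0 1"
    and hola: "a holomorphic_on ball 0 1"
    and H0: "H 0 = 0" and G0: "G 0 = 0"
    and a_less: "z \<in> ball 0 1 \<Longrightarrow> cmod (a z) < 1"
    and dil: "z \<in> ball 0 1 \<Longrightarrow> z * deriv G z = a z * (1 + z * deriv H z)"
    and nz: "z \<in> ball 0 1 \<Longrightarrow> 1 + z * deriv H z \<noteq> 0"
    and f_eq: "z \<in> ball 0 1 \<Longrightarrow> f z = z * exp (H z + cnj (G z))"
    and inj: "inj_on f (ball 0 1)"
    and ray: "\<lbrakk>w \<in> frontier (f ` ball 0 1); of_real t * w \<in> frontier (f ` ball 0 1); t > 0\<rbrakk>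
      \<Longrightarrow> t = 1"
    and bnd: "bounded (f ` ball 0 1)"
    and star: "\<lbrakk>w \<in> f ` ball 0 1; 0 \<le> t; t \<le> 1\<rbrakk> \<Longrightarrow> of_real t * w \<in> f ` ball 0 1"
begin

definition psi :: "complex \<Rightarrow> complex" where "psi z = z * exp (H z - G z)"
definition phi :: "complex \<Rightarrow> complex" where "phi z = z * exp (H z + G z)"

lemma a0: "a 0 = 0"
  using dil[of 0] by simp

lemma a_ne_1: "z \<in> ball 0 1 \<Longrightarrow> 1 - a z \<noteq> 0"
  using a_less[of z] by auto

lemma f_psi: "z \<in> ball 0 1 \<Longrightarrow> f z = of_real (exp (2 * Re (G z))) * psi z"
proof -
  assume "z \<in> ball 0 1"
  have "H z + cnj (G z) = (H z - G z) + of_real (2 * Re (G z))"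
    by (simp add: complex_eq_iff)
  then show ?thesis using f_eq[OF \<open>z \<in> ball 0 1\<close>] 
    by (simp only: exp_add exp_of_real psi_def) (simp add: algebra_simps)
qed

lemma cmod_f_phi: "z \<in> ball 0 1 \<Longrightarrow> cmod (f z) = cmod (phi z)"
  by (simp add: f_eq phi_def norm_mult norm_exp_eq_Re)

lemma contf: "continuous_on (ball 0 1) f"
proof -
  have "continuous_on (ball 0 1) (\<lambda>z. z * exp (H z + cnj (G z)))"
    using holH holG by (intro continuous_intros holomorphic_on_imp_continuous_on)
  then show ?thesis by (rule continuous_on_eq) (simp add: f_eq)
qed

lemma hol_psi: "psi holomorphic_on ball 0 1" and hol_phi: "phi holomorphic_on ball 0 1"
  unfolding psi_def[abs_def] phi_def[abs_def] by (intro holomorphic_intros holH holG)+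

lemma deriv_psi:
  assumes "z \<in> ball 0 1"
  shows "deriv psi z = exp (H z - G z) * ((1 - a z) * (1 + z * deriv H z))"
proof -
  have "(psi has_field_derivative exp (H z - G z) + z * (exp (H z - G z) * (deriv H z - deriv G z))) (at z)"
    unfolding psi_def[abs_def] using assms holH holG
    by (auto intro!: derivative_eq_intros holomorphic_derivI[OF _ open_ball])
  then have "deriv psi z = exp (H z - G z) + z * (exp (H z - G z) * (deriv H z - deriv G z))"
    by (rule DERIV_imp_deriv)
  also have "\<dots> = exp (H z - G z) * (1 + z * deriv H z - z * deriv G z)"
    by (simp add: algebra_simps)
  finally show ?thesis using dil[OF assms] by (simp add: algebra_simps)
qed

lemma deriv_phi:
  assumes "z \<in> ball 0 1"
  shows "deriv phi z = exp (H z + G z) * ((1 + a z) * (1 + z * deriv H z))"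
proof -
  have "(phi has_field_derivative exp (H z + G z) + z * (exp (H z + G z) * (deriv H z + deriv G z))) (at z)"
    unfolding phi_def[abs_def] using assms holH holG
    by (auto intro!: derivative_eq_intros holomorphic_derivI[OF _ open_ball])
  then have "deriv phi z = exp (H z + G z) + z * (exp (H z + G z) * (deriv H z + deriv G z))"
    by (rule DERIV_imp_deriv)
  also have "\<dots> = exp (H z + G z) * (1 + z * deriv H z + z * deriv G z)"
    by (simp add: algebra_simps)
  finally show ?thesis using dil[OF assms] by (simp add: algebra_simps)
qed

lemma hol_P: "(\<lambda>z. (1 + a z) / (1 - a z)) holomorphic_on ball 0 1"
  using a_ne_1 by (intro holomorphic_intros hola) auto

lemma isCont_P: "z \<in> ball 0 1 \<Longrightarrow> isCont (\<lambda>z. (1 + a z) / (1 - a z)) z"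
  using hol_P by (meson continuous_on_eq_continuous_at holomorphic_on_imp_continuous_on open_ball)

text \<open>The lemma \<open>increments_have_same_sign_on_level_line\<close> applied to \<open>q = Ln (psi/psi z1)\<close> and \<open>M = Ln (phi/phi z1)\<close>:
points with \<open>f z\<close> on the ray through \<open>f z1\<close> have \<open>q\<close> real because \<open>arg f = arg psi\<close>, and there
\<open>Re M = ln \<bar>f z / f z1\<bar>\<close>. Dividing by the values at \<open>z1\<close> keeps both principal logarithms
holomorphic near \<open>z1\<close>.\<close>

lemma psi_increases_with_f:
  assumes z1: "z1 \<in> ball 0 1" "z1 \<noteq> 0"
  obtains \<delta> where "\<delta> > 0" "\<And>z t. \<lbrakk>z \<in> ball z1 \<delta>; z \<in> ball 0 1; f z = of_real t * f z1; t > 1\<rbrakk>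
     \<Longrightarrow> cmod (psi z1) < cmod (psi z)"
proof -
  have nz1: "psi z1 \<noteq> 0" "phi z1 \<noteq> 0" using z1 by (auto simp: psi_def phi_def)
  define W where "W = {z \<in> ball 0 1. Re (psi z / psi z1) > 0 \<and> Re (phi z / phi z1) > 0}"
  have "continuous_on (ball 0 1) psi" "continuous_on (ball 0 1) phi"
    using hol_psi hol_phi holomorphic_on_imp_continuous_on by auto
  then have "continuous_on (ball 0 1) (\<lambda>z. Re (psi z / psi z1))"
      "continuous_on (ball 0 1) (\<lambda>z. Re (phi z / phi z1))"
    using nz1 by (auto intro!: continuous_intros)
  then have "open (ball 0 1 \<inter> (\<lambda>z. Re (psi z / psi z1)) -` {0<..})"
      "open (ball 0 1 \<inter> (\<lambda>z. Re (phi z / phi z1)) -` {0<..})"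
    by (simp_all add: continuous_open_preimage)
  moreover have "W = (ball 0 1 \<inter> (\<lambda>z. Re (psi z / psi z1)) -` {0<..}) \<inter>
      (ball 0 1 \<inter> (\<lambda>z. Re (phi z / phi z1)) -` {0<..})"
    by (auto simp: W_def)
  ultimately have "open W" by auto
  moreover have "z1 \<in> W" using z1 nz1 by (simp add: W_def)
  ultimately obtain r where r: "r > 0" "ball z1 r \<subseteq> W" by (auto simp: open_contains_ball)
  define S where "S = ball z1 r"
  have S: "open S" "connected S" "z1 \<in> S" using r by (auto simp: S_def)
  have SD: "z \<in> ball 0 1" "Re (psi z / psi z1) > 0" "Re (phi z / phi z1) > 0" if "z \<in> S" for z
    using r that by (auto simp: S_def W_def)
  then have SU: "S \<subseteq> ball 0 1" by auto
  define q where "q z = Ln (psi z / psi z1)" for z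
  define M where "M z = Ln (phi z / phi z1)" for z
  have slit: "psi z / psi z1 \<notin> \<real>\<^sub>\<le>\<^sub>0" "phi z / phi z1 \<notin> \<real>\<^sub>\<le>\<^sub>0" "psi z \<noteq> 0" "phi z \<noteq> 0" if "z \<in> S" for z
    using SD(2,3)[OF that] by (auto simp: complex_nonpos_Reals_iff)
  have derq: "(q has_field_derivative deriv psi z / psi z) (at z)" if "z \<in> S" for z
    unfolding q_def using slit[OF that] nz1 holomorphic_derivI[OF hol_psi open_ball SD(1)[OF that]]
    by (auto intro!: derivative_eq_intros simp: field_simps)
  have derM: "(M has_field_derivative deriv phi z / phi z) (at z)" if "z \<in> S" for z
    unfolding M_def using slit[OF that] nz1 holomorphic_derivI[OF hol_phi open_ball SD(1)[OF that]]
    by (auto intro!: derivative_eq_intros simp: field_simps)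
  have holq: "q holomorphic_on S" and holM: "M holomorphic_on S"
    using derq derM S(1) by (auto simp: holomorphic_on_open)
  have dM: "deriv M z = (1 + a z) / (1 - a z) * deriv q z" if "z \<in> S" for z
    using DERIV_imp_deriv[OF derq[OF that]] DERIV_imp_deriv[OF derM[OF that]] slit(3,4)[OF that]
      deriv_psi[OF SD(1)[OF that]] deriv_phi[OF SD(1)[OF that]] a_ne_1[OF SD(1)[OF that]]
    by (auto simp: psi_def phi_def)
  have nc: "\<not> q constant_on S"
  proof
    assume "q constant_on S"
    then obtain c where "\<And>z. z \<in> S \<Longrightarrow> q z = c" by (auto simp: constant_on_def)
    then have "(q has_field_derivative 0) (at z1)"
      using has_field_derivative_transform_within_open[OF DERIV_const S(1,3)] by metis
    then have "deriv psi z1 / psi z1 = 0" using derq[OF S(3)] DERIV_unique by blast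
    then show False using deriv_psi[OF z1(1)] a_ne_1 nz z1 nz1 by auto
  qed
  obtain \<delta> where \<delta>: "\<delta> > 0" "ball z1 \<delta> \<subseteq> S" and
    sgn: "\<And>z. \<lbrakk>z \<in> ball z1 \<delta>; z \<noteq> z1; Im (q z) = Im (q z1)\<rbrakk>
       \<Longrightarrow> (Re (q z) - Re (q z1)) * (Re (M z) - Re (M z1)) > 0"
    by (rule increments_have_same_sign_on_level_line[OF S holq nc holM dM isCont_P[OF z1(1)] Re_Cayley_pos[OF a_less[OF z1(1)]]]) auto
  show ?thesis
  proof (rule that[OF \<delta>(1)])
    fix z t assume z: "z \<in> ball z1 \<delta>" "z \<in> ball 0 1" and t: "f z = of_real t * f z1" "t > 1"
    have q1: "q z1 = 0" "M z1 = 0" using nz1 by (auto simp: q_def M_def)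
    define \<rho> where "\<rho> = t * exp (2 * Re (G z1)) / exp (2 * Re (G z))"
    have \<rho>: "\<rho> > 0" using t by (simp add: \<rho>_def)
    have "psi z / psi z1 = of_real \<rho>"
      using t(1) f_psi[OF z(2)] f_psi[OF z1(1)] nz1 by (simp add: \<rho>_def field_simps)
    then have psi: "psi z / psi z1 = of_real \<rho>" "q z = of_real (ln \<rho>)"
      using \<rho> by (auto simp: q_def Ln_of_real)
    have "f z1 \<noteq> 0" using cmod_f_phi[OF z1(1)] nz1 by auto
    then have "z \<noteq> z1" using t by auto
    then have "ln \<rho> * Re (M z) > 0" using sgn[OF z(1)] psi q1 by simp
    moreover have "Re (M z) = ln t"
    proof -
      have "cmod (phi z) = t * cmod (phi z1)"
        using cmod_f_phi[OF z(2)] cmod_f_phi[OF z1(1)] t by (simp add: norm_mult)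
      then have "cmod (phi z / phi z1) = t" using nz1 by (simp add: norm_divide)
      then show ?thesis using t \<delta> z slit[of z] nz1 by (auto simp: M_def)
    qed
    ultimately have "ln \<rho> > 0" using t by (simp add: zero_less_mult_iff)
    then have "\<rho> > 1" using \<rho> by simp
    moreover have "cmod (psi z) = \<rho> * cmod (psi z1)"
      using psi(1) nz1 \<rho> by (simp add: field_simps norm_mult)
    ultimately show "cmod (psi z1) < cmod (psi z)" using nz1 by simp
  qed
qed

lemma f_0: "f 0 = 0"
  by (simp add: f_eq)

lemma psi_eq_0_iff: "psi z = 0 \<longleftrightarrow> z = 0"
  by (simp add: psi_def)

section \<open>Univalence and starlikeness of the analytic part\<close>

lemma inverse_path:
  assumes z0: "z0 \<in> ball 0 1"
  obtains c where "continuous_on {0..1} c" "\<And>t. t \<in> {0..1} \<Longrightarrow> c t \<in> ball 0 1"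
    "\<And>t. t \<in> {0..1} \<Longrightarrow> f (c t) = of_real t * f z0"
proof -
  obtain g where g: "homeomorphism (ball 0 1) (f ` ball 0 1) f g"
    using invariance_of_domain_homeomorphism[of "ball 0 1" f] contf inj by auto
  define c where "c t = g (of_real t * f z0)" for t :: real
  have seg: "of_real t * f z0 \<in> f ` ball 0 1" if "t \<in> {0..1}" for t
    using star[of "f z0" t] that z0 by auto
  show ?thesis
  proof
    show "continuous_on {0..1} c" unfolding c_def
    proof (rule continuous_on_compose2[OF homeomorphism_cont2[OF g]])
      show "(\<lambda>t. complex_of_real t * f z0) ` {0..1} \<subseteq> f ` ball 0 1" using seg by auto
    qed (intro continuous_intros)
    show "c t \<in> ball 0 1" "f (c t) = of_real t * f z0" if "t \<in> {0..1}" for t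
      using seg[OF that] g unfolding c_def homeomorphism_def by blast+
  qed
qed

lemma psi_strictly_increasing:
  assumes z0: "z0 \<in> ball 0 1" "z0 \<noteq> 0"
    and c: "continuous_on {0..1} c" "\<And>t. t \<in> {0..1} \<Longrightarrow> c t \<in> ball 0 1"
    "\<And>t. t \<in> {0..1} \<Longrightarrow> f (c t) = of_real t * f z0"
    and t: "0 < t" "t < 1"
  shows "cmod (psi (c t)) < cmod (psi (c 1))"
proof (rule less_endpoint_if_always_improvable[where s = "\<lambda>t. cmod (psi (c t))"])
  have "f z0 \<noteq> 0" using z0 inj f_0 by (metis centre_in_ball inj_on_def zero_less_one)
  have psic: "continuous_on (ball 0 1) psi"
    using hol_psi holomorphic_on_imp_continuous_on by auto
  have sub: "{t..1} \<subseteq> {0..1}" using t by auto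
  show "continuous_on {t..1} (\<lambda>t. cmod (psi (c t)))"
    using sub c(2)
    by (intro continuous_on_norm continuous_on_compose2[OF psic] continuous_on_subset[OF c(1) sub]) auto
  fix \<tau> assume \<tau>: "t \<le> \<tau>" "\<tau> < 1"
  have c1: "c \<tau> \<in> ball 0 1" "f (c \<tau>) = of_real \<tau> * f z0" using c \<tau> t by auto
  then have "c \<tau> \<noteq> 0" using f_0 \<open>f z0 \<noteq> 0\<close> \<tau> t by auto
  obtain \<delta> where \<delta>: "\<delta> > 0" "\<And>z s. \<lbrakk>z \<in> ball (c \<tau>) \<delta>; z \<in> ball 0 1; f z = of_real s * f (c \<tau>); s > 1\<rbrakk>
     \<Longrightarrow> cmod (psi (c \<tau>)) < cmod (psi z)"
    by (rule psi_increases_with_f[OF c1(1) \<open>c \<tau> \<noteq> 0\<close>]) (rule that; assumption)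
  obtain d where d: "d > 0" "\<And>x. \<lbrakk>x \<in> {0..1}; dist x \<tau> < d\<rbrakk> \<Longrightarrow> dist (c x) (c \<tau>) < \<delta>"
  proof -
    have "\<tau> \<in> {0..1}" using \<tau> t by auto
    then show ?thesis using c(1) \<delta>(1) that unfolding continuous_on_iff by blast
  qed
  define x where "x = min 1 (\<tau> + d/2)"
  have x: "x \<in> {0..1}" "dist x \<tau> < d" "\<tau> < x" using \<tau> t d(1) by (auto simp: x_def dist_real_def)
  have "cmod (psi (c \<tau>)) < cmod (psi (c x))"
  proof (rule \<delta>(2))
    show "c x \<in> ball (c \<tau>) \<delta>" using d(2)[OF x(1,2)] by (simp add: dist_commute)
    show "f (c x) = of_real (x / \<tau>) * f (c \<tau>)" using c(3)[OF x(1)] c1(2) \<tau> t by simp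
    show "1 < x / \<tau>" using x \<tau> t by simp
  qed (use c(2) x in auto)
  then show "\<exists>t'>\<tau>. t' \<le> 1 \<and> cmod (psi (c \<tau>)) < cmod (psi (c t'))" using x by auto
qed (use t in auto)

text \<open>Points with equal values of \<open>psi\<close> have their \<open>f\<close>-values on one ray, and along that ray \<open>\<bar>psi\<bar>\<close>
determines the position.\<close>

lemma inj_psi: "inj_on psi (ball 0 1)"
proof -
  have main: "z1 = z2" if z: "z1 \<in> ball 0 1" "z2 \<in> ball 0 1" and eq: "psi z1 = psi z2"
    and le: "Re (G z1) \<le> Re (G z2)" for z1 z2
  proof (cases "z2 = 0")
    case True
    then show ?thesis using eq psi_eq_0_iff by metis
  next
    case False
    obtain c where c: "continuous_on {0..1} c" "\<And>t. t \<in> {0..1} \<Longrightarrow> c t \<in> ball 0 1"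
      "\<And>t. t \<in> {0..1} \<Longrightarrow> f (c t) = of_real t * f z2"
      by (rule inverse_path[OF z(2)]) (rule that; assumption)
    define t where "t = exp (2 * Re (G z1) - 2 * Re (G z2))"
    have t: "0 < t" "t \<le> 1" using le by (auto simp: t_def)
    have "f z1 = of_real t * f z2"
      using f_psi[OF z(1)] f_psi[OF z(2)] eq by (simp add: t_def exp_diff)
    then have ct: "c t = z1" "c 1 = z2"
      using c(2,3)[of t] c(2,3)[of 1] t z inj by (auto simp: inj_on_def)
    have "\<not> t < 1" using psi_strictly_increasing[OF z(2) False c t(1)] ct eq by auto
    then show ?thesis using ct t by simp
  qed
  show ?thesis
  proof (rule inj_onI)
    fix x y assume "x \<in> ball 0 1" "y \<in> ball 0 1" "psi x = psi y"
    then show "x = y"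
      using main[of x y] main[of y x] by (cases "Re (G x) \<le> Re (G y)") auto
  qed
qed

text \<open>Along the preimage of the segment from \<open>0\<close> to \<open>f z0\<close> the function \<open>psi\<close> stays on one ray, and its
modulus takes all values between \<open>0\<close> and \<open>\<bar>psi z0\<bar>\<close>.\<close>

lemma psi_image_starlike:
  assumes z0: "z0 \<in> ball 0 1" and l: "0 \<le> k" "k \<le> 1"
  shows "of_real k * psi z0 \<in> psi ` ball 0 1"
proof -
  obtain c where c: "continuous_on {0..1} c" "\<And>t. t \<in> {0..1} \<Longrightarrow> c t \<in> ball 0 1"
    "\<And>t. t \<in> {0..1} \<Longrightarrow> f (c t) = of_real t * f z0"
    by (rule inverse_path[OF z0]) (rule that; assumption)
  have psic: "continuous_on (ball 0 1) psi"
    using hol_psi holomorphic_on_imp_continuous_on by auto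
  have cont: "continuous_on {0..1} (\<lambda>t. cmod (psi (c t)))"
    using c(2) by (intro continuous_on_norm continuous_on_compose2[OF psic] c(1)) auto
  have "f (c 0) = f 0" "f (c 1) = f z0" using c(3)[of 0] c(3)[of 1] f_0 by auto
  then have "c 0 = 0" "c 1 = z0" using c(2)[of 0] c(2)[of 1] z0 inj by (auto simp: inj_on_def)
  then have "cmod (psi (c 0)) \<le> k * cmod (psi z0)" "k * cmod (psi z0) \<le> cmod (psi (c 1))"
    using l by (auto simp: psi_def mult_left_le_one_le)
  then obtain t where t: "0 \<le> t" "t \<le> 1" "cmod (psi (c t)) = k * cmod (psi z0)"
    using IVT'[of "\<lambda>t. cmod (psi (c t))" 0 "k * cmod (psi z0)" 1] cont by auto
  define \<rho> where "\<rho> = t * exp (2 * Re (G z0)) / exp (2 * Re (G (c t)))"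
  have ct: "c t \<in> ball 0 1" "f (c t) = of_real t * f z0" using c t by auto
  have psi: "psi (c t) = of_real \<rho> * psi z0"
    using ct(2) f_psi[OF ct(1)] f_psi[OF z0] by (simp add: \<rho>_def field_simps)
  have "\<rho> \<ge> 0" using t by (simp add: \<rho>_def)
  then have "\<rho> * cmod (psi z0) = k * cmod (psi z0)" using t(3) psi by (simp add: norm_mult)
  then have "psi (c t) = of_real k * psi z0" using psi by auto
  then show ?thesis using ct(1) by (metis imageI)
qed

text \<open>Let \<open>g\<close> be the inverse of \<open>psi\<close>. For \<open>0 \<le> k \<le> 1\<close> the map \<open>z \<mapsto> g (k * psi z)\<close> is an analytic self-map
of the disc that fixes \<open>0\<close>, so \<open>\<bar>g (k * psi z0)\<bar> \<le> \<bar>z0\<bar>\<close> with equality at \<open>k = 1\<close>. Hence the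
derivative of the squared modulus at \<open>k = 1\<close>, which is \<open>2 Re (cnj z0 * psi z0 / psi' z0)\<close>, is not
negative. The quantity in the claim is \<open>z0 psi'(z0) / psi z0\<close>, continued to \<open>z0 = 0\<close>.\<close>

lemma Re_starlike_nonneg:
  assumes z0: "z0 \<in> ball 0 1"
  shows "Re ((1 - a z0) * (1 + z0 * deriv H z0)) \<ge> 0"
proof (cases "z0 = 0")
  case True
  then show ?thesis by (simp add: a0)
next
  case False
  obtain g where holg: "g holomorphic_on psi ` ball 0 1"
    and dg: "\<And>z. z \<in> ball 0 1 \<Longrightarrow> deriv psi z * deriv g (psi z) = 1"
    and gpsi: "\<And>z. z \<in> ball 0 1 \<Longrightarrow> g (psi z) = z"
    by (rule holomorphic_has_inverse[OF hol_psi open_ball inj_psi]) (rule that; assumption)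
  have op: "open (psi ` ball 0 1)" using open_mapping_thm3[OF hol_psi open_ball inj_psi] .
  have shrink: "cmod (g (of_real k * psi z0)) \<le> cmod z0" if l: "0 \<le> k" "k \<le> 1" for k
  proof (rule Schwarz_Lemma(1)[where f = "\<lambda>z. g (of_real k * psi z)"])
    have "g \<circ> (\<lambda>z. of_real k * psi z) holomorphic_on ball 0 1"
      using psi_image_starlike[OF _ l] hol_psi
      by (intro holomorphic_on_compose_gen[OF _ holg] holomorphic_intros) auto
    then show "(\<lambda>z. g (of_real k * psi z)) holomorphic_on ball 0 1" by (simp add: o_def)
    show "g (of_real k * psi 0) = 0" using gpsi[of 0] by (simp add: psi_def)
    show "cmod (g (of_real k * psi z)) < 1" if "cmod z < 1" for z
      using psi_image_starlike[OF _ l, of z] gpsi that by auto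
  qed (use z0 in simp)
  define w where "w = psi z0 / deriv psi z0"
  have dnz: "deriv psi z0 \<noteq> 0" using dg[OF z0] by auto
  define y where "y k = g (of_real k * psi z0)" for k :: real
  have "((\<lambda>x. g (x * psi z0)) has_field_derivative deriv g (psi z0) * psi z0) (at (of_real 1))"
    using holomorphic_derivI[OF holg op, of "psi z0"] z0
    by (auto intro!: derivative_eq_intros DERIV_chain2[of g])
  moreover have "deriv g (psi z0) * psi z0 = w" using dg[OF z0] dnz by (simp add: w_def field_simps)
  ultimately have dy: "(y has_vector_derivative w) (at 1)"
    unfolding y_def using has_vector_derivative_real_field by fastforce
  have "((\<lambda>k. (Re (y k))\<^sup>2 + (Im (y k))\<^sup>2) has_real_derivative
      2 * (Re z0 * Re w + Im z0 * Im w)) (at 1)"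
  proof -
    have "((\<lambda>k. Re (y k)) has_real_derivative Re w) (at 1)" "((\<lambda>k. Im (y k)) has_real_derivative Im w) (at 1)"
      using dy by (auto simp: has_real_derivative_iff_has_vector_derivative has_vector_derivative_complex_iff)
    moreover have "y 1 = z0" using gpsi[OF z0] by (simp add: y_def)
    ultimately show ?thesis
      using DERIV_add[OF DERIV_power[of "\<lambda>k. Re (y k)" "Re w" 1 UNIV 2] DERIV_power[of "\<lambda>k. Im (y k)" "Im w" 1 UNIV 2]]
      by (simp add: algebra_simps)
  qed
  then have der: "((\<lambda>k. (cmod (y k))\<^sup>2) has_real_derivative 2 * (Re z0 * Re w + Im z0 * Im w)) (at 1)"
    by (simp add: cmod_power2)
  have "Re z0 * Re w + Im z0 * Im w \<ge> 0"
  proof (rule ccontr)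
    assume "\<not> ?thesis"
    then obtain d where d: "d > 0" "\<And>h. \<lbrakk>0 < h; h < d\<rbrakk> \<Longrightarrow> (cmod (y 1))\<^sup>2 < (cmod (y (1 - h)))\<^sup>2"
      using DERIV_neg_dec_left[OF der] by auto
    define h where "h = min (1/2) (d/2)"
    have h: "0 < h" "h < d" "h \<le> 1/2" using d(1) by (auto simp: h_def)
    have "cmod (y 1) < cmod (y (1 - h))" using power2_less_imp_less[OF d(2)[OF h(1,2)] norm_ge_zero] .
    moreover have "cmod (y (1 - h)) \<le> cmod z0" unfolding y_def using h by (intro shrink) auto
    moreover have "y 1 = z0" using gpsi[OF z0] by (simp add: y_def)
    ultimately show False by simp
  qed
  then have "Re (w * cnj z0) \<ge> 0" by (simp add: mult.commute)
  have Re_scale: "Re (of_real x * w) = x * Re w" for x w by simp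
  define p where "p = (1 - a z0) * (1 + z0 * deriv H z0)"
  have pnz: "p \<noteq> 0" using nz a_ne_1 z0 by (auto simp: p_def)
  have "w * p = z0"
    using pnz unfolding w_def deriv_psi[OF z0] p_def[symmetric] by (simp add: psi_def)
  then have "of_real ((cmod z0)\<^sup>2) * cnj p = w * cnj z0 * of_real ((cmod p)\<^sup>2)"
    unfolding complex_norm_square by (metis (no_types, lifting) complex_cnj_mult mult.assoc mult.commute)
  then have "Re (of_real ((cmod z0)\<^sup>2) * cnj p) = Re (of_real ((cmod p)\<^sup>2) * (w * cnj z0))"
    by (simp only: mult.commute)
  then have "(cmod z0)\<^sup>2 * Re p = (cmod p)\<^sup>2 * Re (w * cnj z0)"
    by (simp only: Re_scale cnj.sel)
  moreover have "\<dots> \<ge> 0" using \<open>Re (w * cnj z0) \<ge> 0\<close> by simp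
  ultimately have "(cmod z0)\<^sup>2 * Re p \<ge> 0" by simp
  moreover have "(cmod z0)\<^sup>2 > 0" using False by simp
  ultimately show ?thesis unfolding p_def by (metis not_le mult_pos_neg)
qed

lemma a_Schwarz: "z \<in> ball 0 1 \<Longrightarrow> cmod (a z) \<le> cmod z"
  using Schwarz_Lemma(1)[OF hola a0] a_less by auto

text \<open>With \<open>p = z psi'/psi\<close> and \<open>w = (p - 1)/(p + 1)\<close> the claim concerns the product of the Cayley transforms of
\<open>a z\<close> and \<open>w z\<close>, both of modulus at most \<open>r = \<bar>z\<bar>\<close>. Up to a positive factor its real part is
\<open>(1 - \<bar>a\<bar>\<^sup>2)(1 - \<bar>w\<bar>\<^sup>2) - 4 Im a Im w \<ge> (1 - r\<^sup>2)\<^sup>2 - 4 r\<^sup>2\<close>, which is positive when \<open>2 r < 1 - r\<^sup>2\<close>.\<close>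

lemma Re_phi_starlike:
  assumes z: "cmod z < sqrt 2 - 1"
  shows "Re ((1 + a z) * (1 + z * deriv H z)) > 0"
proof -
  define r where "r = cmod z"
  have "sqrt 2 < 2" by (simp add: real_less_lsqrt)
  then have r: "0 \<le> r" "r < 1" using z by (auto simp: r_def)
  have r2: "2 * r < 1 - r\<^sup>2"
  proof -
    have "(r + 1)\<^sup>2 < (sqrt 2)\<^sup>2" using z r by (intro power_strict_mono) (auto simp: r_def)
    then show ?thesis by (simp add: power2_eq_square algebra_simps)
  qed
  have zU: "z \<in> ball 0 1" using r by (simp add: r_def)
  define p where "p z = (1 - a z) * (1 + z * deriv H z)" for z
  define w where "w z = (p z - 1) / (p z + 1)" for z
  have p1: "p z + 1 \<noteq> 0" "Re (p z) \<ge> 0" if "z \<in> ball 0 1" for z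
    using Re_starlike_nonneg[OF that] unfolding p_def[symmetric]
    by (auto simp: complex_eq_iff)
  have holw: "w holomorphic_on ball 0 1" unfolding w_def p_def
    using p1 by (intro holomorphic_intros hola holH holomorphic_deriv open_ball) (auto simp: p_def)
  have w1: "cmod (w z) \<le> 1" if "z \<in> ball 0 1" for z
  proof -
    have "(cmod (p z - 1))\<^sup>2 \<le> (cmod (p z + 1))\<^sup>2"
      using p1(2)[OF that] unfolding cmod_power2 by (simp add: power2_eq_square algebra_simps)
    then have "cmod (p z - 1) \<le> cmod (p z + 1)" using power2_le_imp_le norm_ge_zero by blast
    then show ?thesis using p1(1)[OF that] by (simp add: w_def norm_divide divide_le_eq_1)
  qed
  have wr: "cmod (w z) \<le> r"
  (* The Schwarz lemma needs a strict bound, but only |w| <= 1 is known: scale w by c < 1. *)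
  proof (rule field_le_mult_one_interval)
    fix c :: real assume c: "0 < c" "c < 1"
    have "cmod (of_real c * w z) \<le> cmod z"
    proof (rule Schwarz_Lemma(1)[where f = "\<lambda>z. of_real c * w z"])
      show "(\<lambda>z. of_real c * w z) holomorphic_on ball 0 1" by (intro holomorphic_intros holw)
      show "of_real c * w 0 = 0" by (simp add: w_def p_def a0)
      show "cmod (of_real c * w z) < 1" if "cmod z < 1" for z
      proof -
        have "cmod (of_real c * w z) = c * cmod (w z)" using c by (simp add: norm_mult)
        also have "\<dots> \<le> c" using w1[of z] c that by (intro mult_left_le) auto
        finally show ?thesis using c by linarith
      qed
    qed (use zU in simp)
    then show "c * cmod (w z) \<le> r" using c by (simp add: r_def norm_mult)
  qed
  have ar: "cmod (a z) \<le> r" using a_Schwarz[OF zU] by (simp add: r_def)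
  have w_ne: "1 - w z \<noteq> 0" using wr r by auto
  have pw: "p z = (1 + w z) / (1 - w z)"
  proof -
    have "w z * (p z + 1) = p z - 1" using p1(1)[OF zU] by (simp add: w_def)
    then have "p z * (1 - w z) = 1 + w z" by (simp add: algebra_simps)
    then show ?thesis using w_ne by (simp add: eq_divide_eq)
  qed
  have eq: "(1 + a z) * (1 + z * deriv H z) = ((1 + a z) * (1 + w z)) / ((1 - a z) * (1 - w z))"
  proof -
    have "1 + z * deriv H z = p z / (1 - a z)" using a_ne_1[OF zU] by (simp add: p_def)
    then show ?thesis unfolding pw by (simp add: mult.commute)
  qed
  let ?A = "1 - (cmod (a z))\<^sup>2" and ?B = "1 - (cmod (w z))\<^sup>2"
  have "Re (((1 + a z) * (1 + w z)) * cnj ((1 - a z) * (1 - w z))) = ?A * ?B - 4 * Im (a z) * Im (w z)"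
    unfolding cmod_power2 by (simp add: algebra_simps power2_eq_square)
  also have "\<dots> > 0"
  proof -
    have AB: "1 - r\<^sup>2 \<le> ?A" "1 - r\<^sup>2 \<le> ?B" using ar wr by (auto intro!: power_mono)
    have pos: "1 - r\<^sup>2 > 0" using r2 r by linarith
    have "(2 * r) * (2 * r) < (1 - r\<^sup>2) * (1 - r\<^sup>2)" using r2 r pos by (intro mult_strict_mono) auto
    also have "\<dots> \<le> ?A * ?B" using AB pos by (intro mult_mono) auto
    finally have "4 * (r * r) < ?A * ?B" by simp
    moreover have "\<bar>Im (a z) * Im (w z)\<bar> \<le> r * r"
      unfolding abs_mult using ar wr abs_Im_le_cmod[of "a z"] abs_Im_le_cmod[of "w z"] r
      by (intro mult_mono) auto
    ultimately show ?thesis by (simp add: abs_le_iff)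
  qed
  finally have "Re (((1 + a z) * (1 + w z)) * cnj ((1 - a z) * (1 - w z))) > 0" .
  moreover have "(1 - a z) * (1 - w z) \<noteq> 0" using w_ne a_ne_1[OF zU] by simp
  ultimately show ?thesis unfolding eq
    using Re_complex_div_gt_0 by blast
qed

section \<open>Real coefficients\<close>

text \<open>Uniqueness of the map with given dilatation and image, for \<open>f\<close> and \<open>fc = cnj \<circ> f \<circ> cnj\<close>. Where
\<open>q = K - L\<close> is real, \<open>f = exp (Re M) * fc\<close> with \<open>M = K + L\<close>. If \<open>q\<close> is not constant, there is a point
where \<open>q\<close> is real and \<open>Re M = e > 0\<close>. Let \<open>E\<close> be the set where \<open>q\<close> is real and \<open>Re M \<ge> e\<close>. Along a
sequence in \<open>E\<close> that escapes to the unit circle, \<open>f\<close> and \<open>fc\<close> would have limits on the frontier of the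
image, on a common ray and with moduli of ratio at least \<open>exp e > 1\<close>; the frontier has no such pair. So
\<open>E\<close> is compact and \<open>Re M\<close> has a maximum on it, contradicting \<open>increase_on_level_line\<close>.\<close>

lemma real_on_real_axis:
  assumes a_real: "\<And>z. z \<in> ball 0 1 \<Longrightarrow> a (cnj z) = cnj (a z)"
    and sym: "cnj ` (f ` ball 0 1) = f ` ball 0 1"
    and z: "z \<in> ball 0 1"
  shows "H (cnj z) = cnj (H z)" "G (cnj z) = cnj (G z)"
proof -
  define Hc where "Hc = cnj \<circ> H \<circ> cnj"
  define Gc where "Gc = cnj \<circ> G \<circ> cnj"
  define fc where "fc = cnj \<circ> f \<circ> cnj"
  have ball_cnj: "cnj ` ball 0 1 = ball 0 1" 
    by (auto simp: image_cnj_conv_vimage_cnj)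
  have holHc: "Hc holomorphic_on ball 0 1" and holGc: "Gc holomorphic_on ball 0 1"
    unfolding Hc_def Gc_def using holH holG
    by (auto intro!: holomorphic_on_compose_cnj_cnj simp only: ball_cnj)
  have derc: "deriv (cnj \<circ> F \<circ> cnj) z = cnj (deriv F (cnj z))"
    if "F holomorphic_on ball 0 1" "z \<in> ball 0 1" for F z
    using that by (intro DERIV_imp_deriv has_field_derivative_cnj_cnj holomorphic_derivI[OF _ open_ball]) auto
  define K where "K z = H z - Hc z" for z
  define L where "L z = G z - Gc z" for z
  have holK: "K holomorphic_on ball 0 1" and holL: "L holomorphic_on ball 0 1"
    unfolding K_def[abs_def] L_def[abs_def] by (intro holomorphic_intros holH holG holHc holGc)+
  have K0: "K 0 = 0" and L0: "L 0 = 0" by (auto simp: K_def L_def Hc_def Gc_def H0 G0)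
  have derK: "deriv K z = deriv H z - deriv Hc z" and derL: "deriv L z = deriv G z - deriv Gc z"
    if "z \<in> ball 0 1" for z
    unfolding K_def[abs_def] L_def[abs_def]
    using that holH holG holHc holGc
    by (auto intro!: deriv_diff simp: holomorphic_on_imp_differentiable_at)
  have dil_KL: "z * (deriv L z - a z * deriv K z) = 0" if z: "z \<in> ball 0 1" for z
  proof -
    have cz: "cnj z \<in> ball 0 1" using z by simp
    have "cnj (cnj z * deriv G (cnj z)) = cnj (a (cnj z) * (1 + cnj z * deriv H (cnj z)))"
      using dil[OF cz] by simp
    then have "z * deriv Gc z = a z * (1 + z * deriv Hc z)"
      using a_real[OF z] derc[OF holG z] derc[OF holH z] by (simp add: Gc_def Hc_def)
    moreover have "z * (deriv L z - a z * deriv K z) =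
        (z * deriv G z - a z * (1 + z * deriv H z)) - (z * deriv Gc z - a z * (1 + z * deriv Hc z))"
      unfolding derK[OF z] derL[OF z] by (simp add: algebra_simps)
    ultimately show ?thesis using dil[OF z] by simp
  qed
  (* The dilatation equation carries a factor z; differentiating z * D z at 0 removes it there. *)
  define D where "D z = deriv L z - a z * deriv K z" for z
  have holD: "D holomorphic_on ball 0 1" unfolding D_def[abs_def]
    by (intro holomorphic_intros holomorphic_deriv holK holL hola open_ball)
  have "(D has_field_derivative deriv D 0) (at 0)"
    using holD by (rule holomorphic_derivI) auto
  then have "((\<lambda>z. z * D z) has_field_derivative D 0) (at 0)"
    by (rule DERIV_cong[OF DERIV_mult[OF DERIV_ident]]) simp
  moreover have "((\<lambda>z. z * D z) has_field_derivative 0) (at 0)"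
  proof (rule has_field_derivative_transform_within_open)
    show "((\<lambda>_. 0) has_field_derivative 0) (at (0::complex))" by simp
    show "0 = z * D z" if "z \<in> ball 0 1" for z using dil_KL[OF that] by (simp add: D_def)
  qed auto
  ultimately have "D 0 = 0" by (rule DERIV_unique)
  then have derL_K: "deriv L z = a z * deriv K z" if "z \<in> ball 0 1" for z
    using dil_KL[OF that] by (cases "z = 0") (auto simp: D_def)
  define q where "q z = K z - L z" for z
  define M where "M z = K z + L z" for z
  have holq: "q holomorphic_on ball 0 1" and holM: "M holomorphic_on ball 0 1"
    unfolding q_def[abs_def] M_def[abs_def] by (intro holomorphic_intros holK holL)+
  have derq: "deriv q z = (1 - a z) * deriv K z" and derM: "deriv M z = (1 + a z) * deriv K z"
    if "z \<in> ball 0 1" for z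
    unfolding q_def[abs_def] M_def[abs_def]
    using that holK holL derL_K[OF that]
    by (auto simp: holomorphic_on_imp_differentiable_at algebra_simps)
  have derMq: "deriv M z = (1 + a z) / (1 - a z) * deriv q z" if "z \<in> ball 0 1" for z
    using derq[OF that] derM[OF that] a_ne_1[OF that] by simp
  have conj_f: "f z = of_real (exp (Re (M z))) * fc z" if z: "z \<in> ball 0 1" "Im (q z) = 0" for z
  proof -
    have "Re (K z + cnj (L z)) = Re (M z)" "Im (K z + cnj (L z)) = 0"
      using z(2) by (auto simp: q_def M_def)
    then have "H z + cnj (G z) = of_real (Re (M z)) + (Hc z + cnj (Gc z))"
      by (simp add: K_def L_def complex_eq_iff)
    moreover have "fc z = z * exp (Hc z + cnj (Gc z))"
      using f_eq[of "cnj z"] z(1) by (simp add: fc_def Hc_def Gc_def exp_cnj)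
    ultimately show ?thesis using f_eq[OF z(1)] by (simp only: exp_add exp_of_real) (simp add: exp_of_real)
  qed
  have const: "q constant_on ball 0 1"
  proof (rule ccontr)
    assume nc: "\<not> q constant_on ball 0 1"
    have climb: "\<exists>z\<in>ball 0 1. Im (q z) = Im (q z0) \<and> Re (M z) > Re (M z0)" if z0: "z0 \<in> ball 0 1" for z0
      by (rule increase_on_level_line[OF open_ball connected_ball z0 holq nc holM derMq
          isCont_P[OF z0] Re_Cayley_pos[OF a_less[OF z0]]]) auto
    obtain z1 where z1: "z1 \<in> ball 0 1" "Im (q z1) = 0" "Re (M z1) > 0"
      using climb[of 0] by (auto simp: q_def M_def K0 L0)
    define e where "e = Re (M z1)"
    define E where "E = {z \<in> ball 0 1. Im (q z) = 0 \<and> Re (M z) \<ge> e}"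
    have "\<exists>r<1. E \<subseteq> cball 0 r"
    proof (rule ccontr)
      assume no: "\<not> ?thesis"
      have "\<exists>z\<in>E. cmod z > 1 - 1 / real (Suc n)" for n
        using no[unfolded not_ex, rule_format, of "1 - 1 / real (Suc n)"] by (auto simp: not_le)
      then obtain \<zeta> where \<zeta>: "\<And>n. \<zeta> n \<in> E" "\<And>n. cmod (\<zeta> n) > 1 - 1 / real (Suc n)"
        by metis
      have \<zeta>U: "\<zeta> n \<in> ball 0 1" "Im (q (\<zeta> n)) = 0" "Re (M (\<zeta> n)) \<ge> e" for n
        using \<zeta>(1)[of n] by (auto simp: E_def)
      have lim1: "(\<lambda>n. cmod (\<zeta> n)) \<longlonglongrightarrow> 1"
      proof (rule tendsto_sandwich)
        show "(\<lambda>n. 1 - 1 / real (Suc n)) \<longlonglongrightarrow> 1"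
          using tendsto_diff[OF tendsto_const LIMSEQ_inverse_real_of_nat, of 1] by (simp add: inverse_eq_divide)
        show "\<forall>\<^sub>F n in sequentially. 1 - 1 / real (Suc n) \<le> cmod (\<zeta> n)"
          using \<zeta>(2) by (intro always_eventually allI less_imp_le)
        show "\<forall>\<^sub>F n in sequentially. cmod (\<zeta> n) \<le> 1"
          using \<zeta>U(1) by (intro always_eventually allI less_imp_le) simp
      qed (rule tendsto_const)
      let ?\<Omega> = "f ` ball 0 1"
      have fcU: "fc ` ball 0 1 = ?\<Omega>"
        unfolding fc_def using sym ball_cnj by (simp only: image_comp[symmetric])
      have "compact (closure ?\<Omega> \<times> closure ?\<Omega>)"
        using bnd by (intro compact_Times) (simp_all add: compact_closure)
      moreover have "(f (\<zeta> n), fc (\<zeta> n)) \<in> closure ?\<Omega> \<times> closure ?\<Omega>" for n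
        using \<zeta>U(1)[of n] fcU closure_subset[of ?\<Omega>] by blast
      ultimately obtain w r where r: "strict_mono (r :: nat \<Rightarrow> nat)"
        and w: "((\<lambda>n. (f (\<zeta> n), fc (\<zeta> n))) \<circ> r) \<longlonglongrightarrow> w"
        unfolding compact_def by meson
      define w1 w2 where "w1 = fst w" and "w2 = snd w"
      have w1: "(\<lambda>n. f (\<zeta> (r n))) \<longlonglongrightarrow> w1" and w2: "(\<lambda>n. fc (\<zeta> (r n))) \<longlonglongrightarrow> w2"
        using tendsto_fst[OF w] tendsto_snd[OF w] by (auto simp: w1_def w2_def o_def)
      have lim1r: "(\<lambda>n. cmod (\<zeta> (r n))) \<longlonglongrightarrow> 1"
        using LIMSEQ_subseq_LIMSEQ[OF lim1 r] by (simp add: o_def)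
      have fr1: "w1 \<in> frontier ?\<Omega>"
        by (rule frontier_limit_of_escaping_sequence[OF contf inj \<zeta>U(1) lim1r w1])
      have "continuous_on (ball 0 1) fc" unfolding fc_def
        using contf by (intro continuous_on_compose) (auto simp: ball_cnj intro!: continuous_intros)
      moreover have "inj_on fc (ball 0 1)"
      proof (rule inj_onI)
        fix x y assume "x \<in> ball 0 1" "y \<in> ball 0 1" "fc x = fc y"
        then have "cnj x = cnj y" using inj_onD[OF inj, of "cnj x" "cnj y"] by (simp add: fc_def)
        then show "x = y" by simp
      qed
      ultimately have fr2: "w2 \<in> frontier ?\<Omega>"
        using frontier_limit_of_escaping_sequence[OF _ _ \<zeta>U(1) lim1r w2] fcU by simp
      have "0 \<in> ?\<Omega>" using f_0 by (metis centre_in_ball imageI zero_less_one)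
      moreover have "open ?\<Omega>" using invariance_of_domain[OF contf open_ball inj] .
      ultimately have "w2 \<noteq> 0" using fr2 by (auto simp: frontier_def interior_open)
      have fE: "exp e * cmod (fc z) \<le> cmod (f z)" "of_real (cmod (fc z)) * f z = of_real (cmod (f z)) * fc z"
        if "z \<in> E" for z
        using that conj_f[of z] by (auto simp: E_def norm_mult intro!: mult_right_mono)
      have "exp e * cmod w2 \<le> cmod w1"
        by (rule LIMSEQ_le[OF tendsto_mult[OF tendsto_const tendsto_norm[OF w2]] tendsto_norm[OF w1]])
          (use fE(1) \<zeta>(1) in auto)
      have "(\<lambda>n. of_real (cmod (fc (\<zeta> (r n)))) * f (\<zeta> (r n))) \<longlonglongrightarrow> of_real (cmod w2) * w1"
        by (intro tendsto_intros w1 w2)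
      moreover have "(\<lambda>n. of_real (cmod (f (\<zeta> (r n)))) * fc (\<zeta> (r n))) \<longlonglongrightarrow> of_real (cmod w1) * w2"
        by (intro tendsto_intros w1 w2)
      ultimately have "of_real (cmod w2) * w1 = of_real (cmod w1) * w2"
        using fE(2)[OF \<zeta>(1)] LIMSEQ_unique by auto
      then have w12: "w1 = of_real (cmod w1 / cmod w2) * w2" using \<open>w2 \<noteq> 0\<close> by (simp add: field_simps)
      have "exp e > 1" using z1(3) by (simp add: e_def)
      also have "exp e \<le> cmod w1 / cmod w2"
        using \<open>exp e * cmod w2 \<le> cmod w1\<close> \<open>w2 \<noteq> 0\<close> by (simp add: pos_le_divide_eq)
      finally have gt: "cmod w1 / cmod w2 > 1" .
      have fr12: "of_real (cmod w1 / cmod w2) * w2 \<in> frontier ?\<Omega>"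
        using fr1 by (subst w12[symmetric])
      have "cmod w1 / cmod w2 = 1" by (rule ray[OF fr2 fr12]) (use gt in linarith)
      then show False using gt by linarith
    qed
    then obtain r where r: "r < 1" "E \<subseteq> cball 0 r" by blast
    have sub: "cball (0::complex) r \<subseteq> ball 0 1" using r(1) by auto
    have cq: "continuous_on (cball 0 r) (\<lambda>z. Im (q z))" and cM: "continuous_on (cball 0 r) (\<lambda>z. Re (M z))"
      using holomorphic_on_subset[OF holq sub] holomorphic_on_subset[OF holM sub]
      by (auto intro!: continuous_intros holomorphic_on_imp_continuous_on)
    have "closed (cball 0 r \<inter> (\<lambda>z. Im (q z)) -` {0})" "closed (cball 0 r \<inter> (\<lambda>z. Re (M z)) -` {e..})"
      by (intro continuous_closed_preimage cq cM closed_cball closed_singleton closed_atLeast)+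
    moreover have "E = (cball 0 r \<inter> (\<lambda>z. Im (q z)) -` {0}) \<inter> (cball 0 r \<inter> (\<lambda>z. Re (M z)) -` {e..})"
      using r sub by (auto simp: E_def)
    ultimately have "closed E" by auto
    then have "compact E" using r(2) by (metis bounded_cball bounded_subset compact_eq_bounded_closed)
    moreover have "z1 \<in> E" using z1 by (simp add: E_def e_def)
    ultimately obtain z0 where z0: "z0 \<in> E" "\<And>z. z \<in> E \<Longrightarrow> Re (M z) \<le> Re (M z0)"
      using continuous_attains_sup[of E "\<lambda>z. Re (M z)"] continuous_on_subset[OF cM r(2)] by blast
    then obtain z where "z \<in> ball 0 1" "Im (q z) = Im (q z0)" "Re (M z) > Re (M z0)"
      using climb[of z0] by (auto simp: E_def)
    then have "z \<in> E" using z0(1) by (auto simp: E_def)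
    then show False using z0(2) \<open>Re (M z) > Re (M z0)\<close> by force
  qed
  have dK: "deriv K z = 0" if "z \<in> ball 0 1" for z
  proof -
    have "deriv q z = 0" using const holomorphic_nonconstant[OF holq open_ball that] by blast
    then show ?thesis using derq[OF that] a_ne_1[OF that] by simp
  qed
  have zero: "F z = 0" if F: "F holomorphic_on ball 0 1" "F 0 = 0" "\<And>z. z \<in> ball 0 1 \<Longrightarrow> deriv F z = 0" for F
  proof -
    have "\<exists>c. \<forall>z\<in>ball 0 1. F z = c"
      by (rule has_field_derivative_zero_constant)
        (use F holomorphic_derivI[OF F(1) open_ball] in force)+
    then obtain c where "\<And>z. z \<in> ball 0 1 \<Longrightarrow> F z = c" by blast
    from this[OF z] this[of 0] F(2) show ?thesis by simp
  qed
  have "K z = 0" using zero[OF holK K0 dK] .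
  then have "cnj (H z) = cnj (cnj (H (cnj z)))" by (simp add: K_def Hc_def)
  then show "H (cnj z) = cnj (H z)" by simp
  have "L z = 0" using zero[OF holL L0] derL_K dK by simp
  then have "cnj (G z) = cnj (cnj (G (cnj z)))" by (simp add: L_def Gc_def)
  then show "G (cnj z) = cnj (G z)" by simp
qed

section \<open>Typical realness\<close>

text \<open>\<open>A t\<close> is a continuous branch of \<open>arg phi\<close> on the circle of radius \<open>\<bar>z\<bar>\<close>. Its derivative is
\<open>Re (w phi'(w) / phi w)\<close>, positive by \<open>Re_phi_starlike\<close>, so it increases strictly from \<open>A 0 = 0\<close> to \<open>A pi = pi\<close>.\<close>

lemma Im_phi_pos:
  assumes H_real: "\<And>x::real. \<bar>x\<bar> < 1 \<Longrightarrow> H (of_real x) \<in> \<real>"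
    and G_real: "\<And>x::real. \<bar>x\<bar> < 1 \<Longrightarrow> G (of_real x) \<in> \<real>"
    and z: "cmod z < sqrt 2 - 1" "Im z > 0"
  shows "Im (phi z) > 0"
proof -
  define l where "l z = H z + G z" for z
  define r where "r = cmod z"
  define A where "A t = t + Im (l (of_real r * cis t))" for t :: real
  define \<theta> where "\<theta> = Arg z"
  have zr: "z = of_real r * cis \<theta>"
    using rcis_cmod_Arg[of z] by (simp add: r_def \<theta>_def rcis_def)
  have "z \<noteq> 0" using z by auto
  have th: "0 < \<theta>" "\<theta> < pi" using z(2) Arg_lt_pi[of z] by (auto simp: \<theta>_def)
  have "sqrt 2 < 2" by (simp add: real_less_lsqrt)
  then have r: "0 < r" "r < 1" using z \<open>z \<noteq> 0\<close> by (auto simp: r_def)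
  have derA: "(A has_real_derivative Re ((1 + a w) * (1 + w * deriv H w))) (at t)"
    if w: "w = of_real r * cis t" for w t
  proof -
    have cw: "cmod w = r" using r by (simp add: w norm_mult)
    then have wU: "w \<in> ball 0 1" using r by simp
    have "((\<lambda>t. of_real r * cis t) has_vector_derivative \<i> * w) (at t)"
      unfolding has_vector_derivative_def w
      by (auto intro!: derivative_eq_intros simp: algebra_simps scaleR_conv_of_real)
    moreover have "(l has_field_derivative (deriv H w + deriv G w)) (at (of_real r * cis t))"
      unfolding l_def w[symmetric]
      by (intro DERIV_add holomorphic_derivI[OF _ open_ball wU] holH holG)
    ultimately have "((l \<circ> (\<lambda>t. of_real r * cis t)) has_vector_derivative \<i> * w * (deriv H w + deriv G w)) (at t)"
      using field_vector_diff_chain_at by blast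
    then have "((\<lambda>t. Im (l (of_real r * cis t))) has_real_derivative Im (\<i> * w * (deriv H w + deriv G w))) (at t)"
      by (simp add: has_real_derivative_iff_has_vector_derivative has_vector_derivative_complex_iff o_def)
    then have "(A has_real_derivative 1 + Im (\<i> * w * (deriv H w + deriv G w))) (at t)"
      unfolding A_def by (intro DERIV_add DERIV_ident)
    moreover have "\<i> * w * (deriv H w + deriv G w) = \<i> * ((1 + a w) * (1 + w * deriv H w) - 1)"
      using dil[OF wU] by (simp add: algebra_simps)
    ultimately show ?thesis by simp
  qed
  have incr: "A s < A t" if "s < t" for s t
  proof (rule DERIV_pos_imp_increasing[OF that])
    fix x :: real
    have "cmod (of_real r * cis x) < sqrt 2 - 1" using r z by (simp add: norm_mult r_def)
    from Re_phi_starlike[OF this] derA[OF refl, of x]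
    show "\<exists>y. (A has_real_derivative y) (at x) \<and> y > 0" by blast
  qed
  have real_l: "Im (l (of_real x)) = 0" if "\<bar>x\<bar> < 1" for x :: real
    using H_real[OF that] G_real[OF that] by (auto simp: l_def complex_is_Real_iff)
  have "A 0 = 0" using real_l[of r] r by (simp add: A_def)
  moreover have "A pi = pi" using real_l[of "-r"] r by (simp add: A_def)
  ultimately have "0 < A \<theta>" "A \<theta> < pi" using incr th by force+
  then have "sin (A \<theta>) > 0" by (rule sin_gt_zero)
  moreover have "phi z = of_real (r * exp (Re (l z))) * cis (A \<theta>)"
  proof -
    have "phi z = of_real r * cis \<theta> * exp (l z)" using zr by (simp add: phi_def l_def)
    also have "exp (l z) = of_real (exp (Re (l z))) * cis (Im (l z))" by (simp add: exp_eq_polar)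
    finally show ?thesis by (simp add: A_def cis_mult[symmetric] zr[symmetric])
  qed
  ultimately show ?thesis using r by simp
qed

end

section \<open>From the map to its logarithms\<close>

lemma normalized_holomorphic_log:
  assumes h: "h holomorphic_on ball 0 1" "\<And>z. z \<in> ball 0 1 \<Longrightarrow> h z \<noteq> 0" "h 0 = 1"
  obtains H where "H holomorphic_on ball 0 1" "H 0 = 0" "\<And>z. z \<in> ball 0 1 \<Longrightarrow> h z = exp (H z)"
    "\<And>z. z \<in> ball 0 1 \<Longrightarrow> deriv h z = h z * deriv H z"
proof -
  have "contractible (ball (0::complex) 1)" by (simp add: convex_imp_contractible)
  then obtain l where l: "l holomorphic_on ball 0 1" "\<And>z. z \<in> ball 0 1 \<Longrightarrow> h z = exp (l z)"
    using contractible_imp_holomorphic_log[OF h(1)] h(2) by metis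
  define H where "H z = l z - l 0" for z
  have H: "H holomorphic_on ball 0 1" unfolding H_def by (intro holomorphic_intros l)
  have hH: "h z = exp (H z)" if "z \<in> ball 0 1" for z
    using l(2)[OF that] l(2)[of 0] h(3) by (simp add: H_def exp_diff)
  have "deriv h z = h z * deriv H z" if z: "z \<in> ball 0 1" for z
  proof -
    have "(H has_field_derivative deriv H z) (at z)" using H z by (intro holomorphic_derivI) auto
    then have "((\<lambda>w. exp (H w)) has_field_derivative exp (H z) * deriv H z) (at z)"
      by (rule DERIV_fun_exp)
    then have "(h has_field_derivative exp (H z) * deriv H z) (at z)"
      by (rule has_field_derivative_transform_within_open[OF _ open_ball z]) (simp add: hH)
    then show ?thesis using hH[OF z] by (simp add: DERIV_imp_deriv)
  qed
  then show ?thesis using that[of H] H hH by (simp add: H_def)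
qed

lemma wirtinger_of_product:
  assumes h: "h holomorphic_on ball 0 1" and g: "g holomorphic_on ball 0 1"
    and f: "\<And>z. z \<in> ball 0 1 \<Longrightarrow> f z = z * h z * cnj (g z)" and z: "z \<in> ball 0 1"
  shows "wirtinger_z f z = (h z + z * deriv h z) * cnj (g z)"
    and "wirtinger_zbar f z = z * h z * cnj (deriv g z)"
proof -
  have dh: "(h has_derivative (\<lambda>v. deriv h z * v)) (at z)" and dg: "(g has_derivative (\<lambda>v. deriv g z * v)) (at z)"
    using h g z by (auto intro!: holomorphic_derivI simp flip: has_field_derivative_def)
  have "((\<lambda>z. z * h z * cnj (g z)) has_derivative
      (\<lambda>v. z * h z * cnj (deriv g z * v) + (z * (deriv h z * v) + v * h z) * cnj (g z))) (at z)"
    by (intro has_derivative_mult has_derivative_ident dh has_derivative_cnj dg)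
  then have "(f has_derivative
      (\<lambda>v. z * h z * cnj (deriv g z * v) + (z * (deriv h z * v) + v * h z) * cnj (g z))) (at z)"
    by (rule has_derivative_transform_within_open[OF _ open_ball z]) (simp add: f)
  then have fd: "frechet_derivative f (at z) =
      (\<lambda>v. z * h z * cnj (deriv g z * v) + (z * (deriv h z * v) + v * h z) * cnj (g z))"
    by (metis frechet_derivative_at)
  show "wirtinger_z f z = (h z + z * deriv h z) * cnj (g z)"
    and "wirtinger_zbar f z = z * h z * cnj (deriv g z)"
    unfolding wirtinger_z_def wirtinger_zbar_def fd by (simp_all add: algebra_simps)
qed

theorem theorem5:
  fixes f h g a :: "complex \<Rightarrow> complex"
  assumes "h holomorphic_on ball 0 1" and "g holomorphic_on ball 0 1"
    and "\<And>z. z \<in> ball 0 1 \<Longrightarrow> f z = z * h z * cnj (g z)"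
    and "logharmonic_on f (ball 0 1)"
    and "inj_on f (ball 0 1)"
    and "sense_preserving_on f (ball 0 1)"
    and "h 0 = 1" and "g 0 = 1"
    and "second_dilatation f a (ball 0 1)"
    and "\<And>z. z \<in> ball 0 1 \<Longrightarrow> a (cnj z) = cnj (a z)"
    and "strictly_starlike_jordan_domain (f ` ball 0 1)"
    and "cnj ` (f ` ball 0 1) = f ` ball 0 1"
  shows "typically_real_on (\<lambda>z. z * h z * g z) (ball 0 (sqrt 2 - 1))"
proof -
  note h = assms(1) and g = assms(2) and f = assms(3) and inj = assms(5)
  let ?U = "ball (0::complex) 1"
  have f0: "f 0 = 0" by (simp add: f)
  have f_nz: "f z \<noteq> 0" if "z \<in> ?U" "z \<noteq> 0" for z
    using inj_onD[OF inj, of z 0] that f0 by auto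
  have h_nz: "h z \<noteq> 0" and g_nz: "g z \<noteq> 0" if "z \<in> ?U" for z
    using f_nz[OF that] f[OF that] assms(7,8) by (cases "z = 0"; simp)+
  obtain H where H: "H holomorphic_on ?U" "H 0 = 0" "\<And>z. z \<in> ?U \<Longrightarrow> h z = exp (H z)"
    and dH: "\<And>z. z \<in> ?U \<Longrightarrow> deriv h z = h z * deriv H z"
    by (rule normalized_holomorphic_log[OF h h_nz assms(7)]) (auto intro: that)
  obtain G where G: "G holomorphic_on ?U" "G 0 = 0" "\<And>z. z \<in> ?U \<Longrightarrow> g z = exp (G z)"
    and dG: "\<And>z. z \<in> ?U \<Longrightarrow> deriv g z = g z * deriv G z"
    by (rule normalized_holomorphic_log[OF g g_nz assms(8)]) (auto intro: that)
  have W: "wirtinger_z f z = (h z + z * deriv h z) * cnj (g z)"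
    "wirtinger_zbar f z = z * h z * cnj (deriv g z)" if "z \<in> ?U" for z
    using wirtinger_of_product[of h g f z] h g f that by simp_all
  have Wz: "wirtinger_z f z = h z * (1 + z * deriv H z) * cnj (g z)" if "z \<in> ?U" for z
    using W(1)[OF that] dH[OF that] by (simp add: algebra_simps)
  have Wzbar: "wirtinger_zbar f z = z * h z * cnj (g z * deriv G z)" if "z \<in> ?U" for z
    using W(2)[OF that] dG[OF that] by simp
  have holW: "1 + z * deriv H z \<noteq> 0" if "z \<in> ?U" for z
  proof
    assume "1 + z * deriv H z = 0"
    then have "wirtinger_z f z = 0" using Wz[OF that] by simp
    then show False using assms(6) that unfolding sense_preserving_on_def by fastforce
  qed
  have a: "a holomorphic_on ?U" "\<And>z. z \<in> ?U \<Longrightarrow> cmod (a z) < 1"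
    and a_dil: "\<And>z. z \<in> ?U \<Longrightarrow> f z \<noteq> 0 \<Longrightarrow> cnj (wirtinger_zbar f z / f z) = a z * (wirtinger_z f z / f z)"
    using assms(9) unfolding second_dilatation_def by auto
  have dil_nz: "z * deriv G z = a z * (1 + z * deriv H z)" if z: "z \<in> ?U" "z \<noteq> 0" for z
  proof -
    have "wirtinger_zbar f z / f z = cnj (deriv G z)"
      using z h_nz[OF z(1)] g_nz[OF z(1)] by (simp add: Wzbar f)
    moreover have "wirtinger_z f z / f z = (1 + z * deriv H z) / z"
      using z h_nz[OF z(1)] g_nz[OF z(1)] by (simp add: Wz f)
    ultimately have "deriv G z = a z * ((1 + z * deriv H z) / z)"
      using a_dil[OF z(1) f_nz[OF z]] by simp
    then show ?thesis using z(2) by simp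
  qed
  \<comment> \<open>At the origin, where the dilatation equation says nothing, continuity is needed.\<close>
  have dil: "z * deriv G z = a z * (1 + z * deriv H z)" if z: "z \<in> ?U" for z
  proof (cases "z = 0")
    case True
    have "(\<lambda>w. w * deriv G w - a w * (1 + w * deriv H w)) holomorphic_on ?U"
      by (intro holomorphic_intros holomorphic_deriv H G a open_ball)
    then have "isCont (\<lambda>w. w * deriv G w - a w * (1 + w * deriv H w)) 0"
      by (meson centre_in_ball continuous_on_eq_continuous_at holomorphic_on_imp_continuous_on
          open_ball zero_less_one)
    then have "((\<lambda>w. w * deriv G w - a w * (1 + w * deriv H w)) \<longlongrightarrow> - a 0) (at 0)"
      by (simp add: isCont_def)
    moreover have "((\<lambda>w. w * deriv G w - a w * (1 + w * deriv H w)) \<longlongrightarrow> 0) (at 0)"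
    proof (rule tendsto_eventually)
      have "\<forall>\<^sub>F w in at 0. w \<in> ?U \<and> w \<noteq> 0"
        using eventually_at_in_open[OF open_ball, of "0::complex" 0 1] by (simp add: eventually_mono)
      then show "\<forall>\<^sub>F w in at 0. w * deriv G w - a w * (1 + w * deriv H w) = 0"
        by eventually_elim (simp add: dil_nz)
    qed
    ultimately have "- a 0 = 0" using tendsto_unique trivial_limit_at by blast
    then show ?thesis using True by simp
  qed (rule dil_nz[OF z])
  have f_exp: "f z = z * exp (H z + cnj (G z))" if "z \<in> ?U" for z
    using f[OF that] H(3)[OF that] G(3)[OF that] by (simp add: exp_add exp_cnj)
  have contf: "continuous_on ?U f"
  proof -
    have "continuous_on ?U (\<lambda>z. z * h z * cnj (g z))"
      using h g by (intro continuous_intros holomorphic_on_imp_continuous_on)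
    then show ?thesis by (rule continuous_on_eq) (simp add: f)
  qed
  have jd: "jordan_domain (f ` ?U)"
    and rays: "\<forall>u. cmod u = 1 \<longrightarrow> (\<exists>!w. w \<in> radial_ray u \<inter> frontier (f ` ?U))"
    using assms(11) unfolding strictly_starlike_jordan_domain_def by auto
  have bdd: "bounded (f ` ?U)"
    using jd unfolding jordan_domain_def
    by (metis bounded_inside bounded_simple_path_image)
  have "open (f ` ?U)" using invariance_of_domain[OF contf open_ball inj] .
  moreover have "0 \<in> f ` ?U" using f0 by (metis centre_in_ball imageI zero_less_one)
  ultimately have star: "\<lbrakk>w \<in> frontier (f ` ?U); of_real t * w \<in> frontier (f ` ?U); t > 0\<rbrakk> \<Longrightarrow> t = 1"
    "\<lbrakk>w \<in> f ` ?U; 0 \<le> t; t \<le> 1\<rbrakk> \<Longrightarrow> of_real t * w \<in> f ` ?U" for w t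
    using starlike_of_unique_ray_crossing[OF _ bdd _ rays] by blast+
  interpret starlike_logharmonic H G a f
    by unfold_locales (use H G a dil holW f_exp inj star bdd in auto)
  have small: "ball 0 (sqrt 2 - 1) \<subseteq> ?U"
    by (rule subset_ball) (simp add: real_le_lsqrt)
  have real: "H (cnj z) = cnj (H z)" "G (cnj z) = cnj (G z)" if "z \<in> ?U" for z
    using real_on_real_axis[of z] assms(10,12) that by simp_all
  have phi_eq: "z * h z * g z = phi z" if "z \<in> ?U" for z
    using H(3)[OF that] G(3)[OF that] by (simp add: phi_def exp_add)
  have phi_cnj: "phi (cnj z) = cnj (phi z)" if "z \<in> ?U" for z
    using real[OF that] by (simp add: phi_def exp_cnj)
  have axis: "H (of_real x) \<in> \<real>" "G (of_real x) \<in> \<real>" if "\<bar>x\<bar> < 1" for x :: real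
    using real[of "of_real x"] that by (auto simp: complex_is_Real_iff complex_eq_iff)
  have upper: "Im (phi z) > 0" if "z \<in> ball 0 (sqrt 2 - 1)" "Im z > 0" for z
    using Im_phi_pos[OF axis] that by simp
  show ?thesis unfolding typically_real_on_def
  proof (intro conjI ballI impI)
    show "(\<lambda>z. z * h z * g z) holomorphic_on ball 0 (sqrt 2 - 1)"
      using small h g by (intro holomorphic_intros) (auto intro: holomorphic_on_subset)
  next
    fix z :: complex assume z: "z \<in> ball 0 (sqrt 2 - 1)"
    then have zU: "z \<in> ?U" using small by blast
    show "z * h z * g z \<in> \<real>" if "z \<in> \<real>"
      using phi_cnj[OF zU] that phi_eq[OF zU] by (simp add: Reals_cnj_iff)
    show "z * h z * g z \<notin> \<real>" if "z \<notin> \<real>"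
    proof (cases "Im z > 0")
      case True
      then show ?thesis using upper[OF z] phi_eq[OF zU] by (simp add: complex_is_Real_iff)
    next
      case False
      then have "Im (phi (cnj z)) > 0" using upper[of "cnj z"] z that by (simp add: complex_is_Real_iff)
      then show ?thesis using phi_cnj[OF zU] phi_eq[OF zU] by (simp add: complex_is_Real_iff)
    qed
  qed
qed

end
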